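(* Let $(X_k)_{k\ge 1}$ be a sequence of real-valued random variables on a probability space $(\Omega,\mathcal{K},P_X)$, and let $Y$ be a real-valued random variable such that, for some constant $M>0$, $$\frac1n\sum_{k=1}^n P(|X_k|>x)\le M\,P(|Y|>x)\quad\text{for all } x>0 \text{ and all integers } n\ge 1.$$ Let $0<p<2$. If $E|Y|^p<\infty$, then $$n^{p/2-1}\, E_{\tilde\theta_n}|S_n(\tilde\theta_n)|^p\to 0\quad\text{as } n\to\infty,$$ both in $P_X$-probability and in $L^1(\Omega)$.
   Context: For $n\ge 2$, $\tilde\theta_n=(\theta_{n,1},\dots,\theta_{n,n})$ is a random vector distributed uniformly on the unit sphere $\mathbb{S}^{n-1}\subset\mathbb{R}^n$ (i.e. according to the unique rotationally invariant probability measure $P_{\tilde\theta_n}$ on $\mathbb{S}^{n-1}$), independent of $(X_1,\dots,X_n)$, and $S_n(\tilde\theta_n)=\theta_{n,1}X_1+\cdots+\theta_{n,n}X_n$. The symbol $E_{\tilde\theta_n}$ denotes expectation with respect to $P_{\tilde\theta_n}$ only, so that $E_{\tilde\theta_n}|S_n(\tilde\theta_n)|^p$ is the random variable on $\Omega$ given by $\omega\mapsto\int_{\mathbb{S}^{n-1}}\left|\sum_{k=1}^n u_kX_k(\omega)\right|^p dP_{\tilde\theta_n}(u)$. No independence among the $X_k$ is assumed. *)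

theory Defs
  imports "HOL-Probability.Probability"
begin

text \<open>
  The dimension varies along the sequence, so a vector of \<open>\<real>\<^sup>n\<close> is a function on
  \<open>{1..n}\<close>, extended by \<^const>\<open>undefined\<close>, and the Borel sets of \<open>\<real>\<^sup>n\<close> are those of
  the product sigma algebra.
\<close>

definition unit_sphere :: "nat \<Rightarrow> (nat \<Rightarrow> real) set" where
  "unit_sphere n = {u \<in> {1..n} \<rightarrow>\<^sub>E UNIV. (\<Sum>k=1..n. (u k)\<^sup>2) = 1}"

definition sphere_algebra :: "nat \<Rightarrow> (nat \<Rightarrow> real) measure" where
  "sphere_algebra n = restrict_space (PiM {1..n} (\<lambda>_. borel)) (unit_sphere n)"

definition orthogonal_mat :: "nat \<Rightarrow> (nat \<Rightarrow> nat \<Rightarrow> real) \<Rightarrow> bool" where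
  "orthogonal_mat n A \<longleftrightarrow>
     (\<forall>i\<in>{1..n}. \<forall>j\<in>{1..n}. (\<Sum>k=1..n. A k i * A k j) = (if i = j then 1 else 0))"

definition mat_apply :: "nat \<Rightarrow> (nat \<Rightarrow> nat \<Rightarrow> real) \<Rightarrow> (nat \<Rightarrow> real) \<Rightarrow> nat \<Rightarrow> real" where
  "mat_apply n A u = (\<lambda>i\<in>{1..n}. \<Sum>k=1..n. A i k * u k)"

text \<open>
  Rotational invariance is invariance under the full orthogonal group; for \<open>n \<ge> 2\<close> the
  special orthogonal group already acts transitively on the sphere and determines the same
  measure.
\<close>

definition uniform_on_sphere :: "nat \<Rightarrow> (nat \<Rightarrow> real) measure \<Rightarrow> bool" where
  "uniform_on_sphere n P \<longleftrightarrow>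
     prob_space P \<and> sets P = sets (sphere_algebra n) \<and>
     (\<forall>A. orthogonal_mat n A \<longrightarrow> distr P P (mat_apply n A) = P)"

text \<open>
  \<^const>\<open>distr\<close> is the image measure only along measurable maps; the next two lemmas show
  that it is used properly above.
\<close>

lemma mat_apply_unit_sphere:
  assumes "orthogonal_mat n A" "u \<in> unit_sphere n"
  shows "mat_apply n A u \<in> unit_sphere n"
proof -
  have "(\<Sum>i=1..n. (mat_apply n A u i)\<^sup>2)
      = (\<Sum>i=1..n. \<Sum>k=1..n. \<Sum>l=1..n. u k * u l * (A i k * A i l))"
    by (simp add: mat_apply_def power2_eq_square sum_product mult_ac)
  also have "\<dots> = (\<Sum>k=1..n. \<Sum>i=1..n. \<Sum>l=1..n. u k * u l * (A i k * A i l))"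
    by (rule sum.swap)
  also have "\<dots> = (\<Sum>k=1..n. \<Sum>l=1..n. \<Sum>i=1..n. u k * u l * (A i k * A i l))"
    by (rule sum.cong[OF refl], rule sum.swap)
  also have "\<dots> = (\<Sum>k=1..n. \<Sum>l=1..n. u k * u l * (if k = l then 1 else 0))"
    using assms(1) by (simp add: orthogonal_mat_def sum_distrib_left[symmetric])
  also have "\<dots> = (\<Sum>k=1..n. (u k)\<^sup>2)"
    by (simp add: power2_eq_square if_distrib[of "\<lambda>x. _ * x"] cong: if_cong)
  finally show ?thesis
    using assms(2) by (simp add: unit_sphere_def mat_apply_def)
qed

lemma measurable_mat_apply:
  assumes "orthogonal_mat n A"
  shows "mat_apply n A \<in> measurable (sphere_algebra n) (sphere_algebra n)"
  unfolding sphere_algebra_def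
proof (rule measurable_restrict_space3)
  show "mat_apply n A \<in> measurable (PiM {1..n} (\<lambda>_. borel)) (PiM {1..n} (\<lambda>_. borel))"
    unfolding mat_apply_def by measurable
qed (use mat_apply_unit_sphere[OF assms] in auto)

definition sphere_moment ::
    "(nat \<Rightarrow> real) measure \<Rightarrow> real \<Rightarrow> (nat \<Rightarrow> 'a \<Rightarrow> real) \<Rightarrow> nat \<Rightarrow> 'a \<Rightarrow> real" where
  "sphere_moment P p X n \<omega> = (\<integral>u. \<bar>\<Sum>k=1..n. u k * X k \<omega>\<bar> powr p \<partial>P)"

text \<open>
  \<^const>\<open>measure\<close> and the Bochner integral are 0 at non-measurable sets and non-integrable
  functions, hence the explicit measurability and integrability conditions. They are imposed
  eventually, as the first few terms play no role in a limit.
\<close>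

definition tendsto_in_prob :: "'a measure \<Rightarrow> (nat \<Rightarrow> 'a \<Rightarrow> real) \<Rightarrow> ('a \<Rightarrow> real) \<Rightarrow> bool" where
  "tendsto_in_prob M T Z \<longleftrightarrow>
     Z \<in> borel_measurable M \<and> (\<forall>\<^sub>F n in sequentially. T n \<in> borel_measurable M) \<and>
     (\<forall>\<epsilon>>0. (\<lambda>n. measure M {\<omega> \<in> space M. \<bar>T n \<omega> - Z \<omega>\<bar> > \<epsilon>}) \<longlonglongrightarrow> 0)"

definition tendsto_in_L1 :: "'a measure \<Rightarrow> (nat \<Rightarrow> 'a \<Rightarrow> real) \<Rightarrow> ('a \<Rightarrow> real) \<Rightarrow> bool" where
  "tendsto_in_L1 M T Z \<longleftrightarrow>
     integrable M Z \<and> (\<forall>\<^sub>F n in sequentially. integrable M (T n)) \<and>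
     (\<lambda>n. \<integral>\<omega>. \<bar>T n \<omega> - Z \<omega>\<bar> \<partial>M) \<longlonglongrightarrow> 0"

end

theory Submission
  imports Defs
begin

text \<open>
  By invariance under coordinate swaps and sign changes, the coordinates \<open>u\<^sub>k\<close> on the sphere are
  uncorrelated with second moment \<open>1/n\<close>. Jensen's inequality for the concave function
  \<open>t \<mapsto> t powr (p/2)\<close> therefore bounds the rescaled moment by \<open>(1/n) (\<Sum>k. X\<^sub>k^2) powr (p/2)\<close>,
  without any independence. Truncating at level \<open>a\<close> and using subadditivity of the same function,
  this is at most \<open>a powr p * n powr (p/2 - 1) + (1/n) (\<Sum>k. \<bar>X\<^sub>k\<bar> powr p * 1{\<bar>X\<^sub>k\<bar> > a})\<close>.
  The layer cake formula turns the domination of averaged tail probabilities into the bound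
  \<open>C * E(\<bar>Y\<bar> powr p * 1{\<bar>Y\<bar> > a})\<close> for the expectation of the second term. Let \<open>n \<rightarrow> \<infinity>\<close>, then
  \<open>a \<rightarrow> \<infinity>\<close>.
\<close>

section \<open>Powers with exponent below one: tangent bound, Jensen, subadditivity\<close>

text \<open>The right-hand side is the tangent at \<open>s\<close> of the concave function
  \<open>t powr q\<close>. The bound is the weighted Young inequality for \<open>t / s\<close> and
  \<open>1\<close> with weights \<open>q\<close> and \<open>1 - q\<close>; it is applied to positive
  numbers, so \<open>t = 0\<close> is split off.\<close>

lemma powr_le_tangent:
  fixes q s t :: real
  assumes "0 < q" "q < 1" "0 < s" "0 \<le> t"
  shows "t powr q \<le> s powr q * (q * (t / s) + (1 - q))"
proof (cases "t = 0")
  case False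
  have "(t / s) powr q * 1 powr (1 - q) \<le> q * (t / s) + (1 - q) * 1"
    using assms False by (intro Youngs_inequality_0) auto
  then have "s powr q * (t / s) powr q \<le> s powr q * (q * (t / s) + (1 - q))"
    by (intro mult_left_mono) auto
  then show ?thesis
    using assms by (simp add: powr_divide)
qed (use assms in auto)

text \<open>Jensen's inequality, obtained by integrating the tangent at the mean of
  \<open>Z\<close>. The affine tangent bound also yields integrability.\<close>

lemma (in prob_space) expectation_powr_le:
  fixes Z :: "'a \<Rightarrow> real"
  assumes q: "0 < q" "q < 1" and Z: "integrable M Z" "\<And>x. 0 \<le> Z x"
  shows "integrable M (\<lambda>x. Z x powr q)" "expectation (\<lambda>x. Z x powr q) \<le> expectation Z powr q"
proof -
  have [measurable]: "Z \<in> borel_measurable M"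
    using Z(1) by auto
  show int: "integrable M (\<lambda>x. Z x powr q)"
  proof (rule Bochner_Integration.integrable_bound)
    \<comment> \<open>The tangent at \<open>1\<close>, left unsimplified so that it matches
      \<open>powr_le_tangent\<close> with \<open>s = 1\<close>.\<close>
    show "integrable M (\<lambda>x. 1 powr q * (q * (Z x / 1) + (1 - q)))"
      using Z by simp
    show "AE x in M. norm (Z x powr q) \<le> norm (1 powr q * (q * (Z x / 1) + (1 - q)))"
      using powr_le_tangent[OF q zero_less_one Z(2)] by (intro AE_I2) (auto intro: order_trans abs_ge_self)
  qed measurable
  show "expectation (\<lambda>x. Z x powr q) \<le> expectation Z powr q"
  proof (cases "expectation Z = 0")
    case True
    \<comment> \<open>A zero mean is no admissible tangent point, but it forces \<open>Z\<close> to
      vanish almost everywhere.\<close>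
    then have "AE x in M. Z x = 0"
      using Z by (subst (asm) integral_nonneg_eq_0_iff_AE) auto
    then have "expectation (\<lambda>x. Z x powr q) = expectation (\<lambda>x. 0)"
      by (intro integral_cong_AE) auto
    then show ?thesis by simp
  next
    case False
    define s where "s = expectation Z"
    have s: "s > 0"
      using False Z(2) by (simp add: s_def less_le integral_nonneg)
    have "expectation (\<lambda>x. Z x powr q) \<le> expectation (\<lambda>x. s powr q * (q * (Z x / s) + (1 - q)))"
      using Z int by (intro integral_mono powr_le_tangent q s) auto
    also have "\<dots> = s powr q * (q * (expectation Z / s) + (1 - q))"
      using Z by (simp add: prob_space)
    also have "\<dots> = s powr q"
      using s by (simp flip: s_def)
    finally show ?thesis by (simp add: s_def)
  qed
qed

text \<open>Dividing by \<open>s = x + y\<close> turns the summands into fractions in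
  \<open>[0, 1]\<close> with sum 1, and lowering the exponent from 1 to \<open>q\<close> can only
  increase such a fraction.\<close>

lemma powr_add_le_powr_plus_powr:
  fixes x y q :: real
  assumes "0 < q" "q \<le> 1" "0 \<le> x" "0 \<le> y"
  shows "(x + y) powr q \<le> x powr q + y powr q"
proof (cases "x + y = 0")
  case False
  define s where "s = x + y"
  have s: "s > 0" using False assms by (simp add: s_def)
  have le: "z / s \<le> (z / s) powr q" if "0 \<le> z" "z \<le> s" for z
    using powr_mono'[of q 1 "z / s"] assms s that by simp
  have "s powr q = s powr q * (x / s + y / s)"
    using s by (simp add: s_def flip: add_divide_distrib)
  also have "\<dots> \<le> s powr q * ((x / s) powr q + (y / s) powr q)"
    using assms by (intro mult_left_mono add_mono le) (auto simp: s_def)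
  also have "\<dots> = x powr q + y powr q"
    using s by (simp add: powr_divide field_simps)
  finally show ?thesis by (simp add: s_def)
qed (use assms in simp)

lemma powr_sum_le_sum_powr:
  fixes f :: "'i \<Rightarrow> real"
  assumes "finite A" "0 < q" "q \<le> 1" "\<And>i. i \<in> A \<Longrightarrow> 0 \<le> f i"
  shows "(\<Sum>i\<in>A. f i) powr q \<le> (\<Sum>i\<in>A. f i powr q)"
  using assms(1,4)
proof (induction A)
  case (insert i A)
  have "(f i + sum f A) powr q \<le> f i powr q + sum f A powr q"
    using insert.prems assms by (intro powr_add_le_powr_plus_powr) (auto intro: sum_nonneg)
  with insert show ?case by fastforce
qed simp

text \<open>Squares of entries up to level \<open>a\<close> are replaced by the square of
  \<open>a\<close>; the larger ones are kept in \<open>?b\<close>. Subadditivity of the power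
  \<open>p / 2\<close> then separates the two contributions and splits the second one into its
  terms.\<close>

lemma powr_sum_squares_le_truncated:
  fixes x :: "nat \<Rightarrow> real"
  assumes p: "0 < p" "p < 2" and a: "0 < a"
  shows "(\<Sum>k=1..n. (x k)\<^sup>2) powr (p / 2)
    \<le> real n powr (p / 2) * a powr p + (\<Sum>k=1..n. \<bar>x k\<bar> powr p * indicator {a<..} \<bar>x k\<bar>)"
proof -
  let ?b = "\<lambda>k. (x k)\<^sup>2 * indicator {a<..} \<bar>x k\<bar>"
  have "(x k)\<^sup>2 \<le> a\<^sup>2 + ?b k" for k
    using power_mono[of "\<bar>x k\<bar>" a 2] by (auto simp: indicator_def)
  then have "(\<Sum>k=1..n. (x k)\<^sup>2) \<le> real n * a\<^sup>2 + (\<Sum>k=1..n. ?b k)"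
    using sum_mono[of "{1..n}" "\<lambda>k. (x k)\<^sup>2" "\<lambda>k. a\<^sup>2 + ?b k"] by (simp add: sum.distrib)
  then have "(\<Sum>k=1..n. (x k)\<^sup>2) powr (p / 2) \<le> (real n * a\<^sup>2 + (\<Sum>k=1..n. ?b k)) powr (p / 2)"
    using p by (intro powr_mono2) (auto intro: sum_nonneg)
  also have "\<dots> \<le> (real n * a\<^sup>2) powr (p / 2) + (\<Sum>k=1..n. ?b k) powr (p / 2)"
    using p by (intro powr_add_le_powr_plus_powr) (auto intro: sum_nonneg)
  also have "\<dots> \<le> (real n * a\<^sup>2) powr (p / 2) + (\<Sum>k=1..n. ?b k powr (p / 2))"
    using p by (intro add_left_mono powr_sum_le_sum_powr) auto
  \<comment> \<open>The indicator takes only the values 0 and 1, and \<open>0 powr r = 0\<close>, so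
    it passes through the power unchanged.\<close>
  also have "(\<Sum>k=1..n. ?b k powr (p / 2)) = (\<Sum>k=1..n. \<bar>x k\<bar> powr p * indicator {a<..} \<bar>x k\<bar>)"
  proof (intro sum.cong refl)
    fix k
    have "(x k)\<^sup>2 powr (p / 2) = \<bar>x k\<bar> powr p"
      using powr_powr[of "\<bar>x k\<bar>" 2 "p / 2"] by simp
    then show "?b k powr (p / 2) = \<bar>x k\<bar> powr p * indicator {a<..} \<bar>x k\<bar>"
      by (auto simp: indicator_def)
  qed
  also have "(real n * a\<^sup>2) powr (p / 2) = real n powr (p / 2) * a powr p"
    using a powr_powr[of a 2 "p / 2"] by (simp add: powr_mult)
  finally show ?thesis .
qed

section \<open>Tail probabilities and truncated moments\<close>

text \<open>Both sides are the product measure of the region under the graph of \<open>f\<close>: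
  slicing at \<open>x\<close> gives the interval \<open>{0..<f x}\<close> of length
  \<open>f x\<close>, and slicing at \<open>t\<close> gives a superlevel set. Fubini exchanges the
  slices.\<close>

lemma (in sigma_finite_measure) nn_integral_layer_cake:
  fixes f :: "'a \<Rightarrow> real"
  assumes [measurable]: "f \<in> borel_measurable M" and nonneg: "\<And>x. 0 \<le> f x"
  shows "(\<integral>\<^sup>+x. f x \<partial>M) = (\<integral>\<^sup>+t. emeasure M {x \<in> space M. t < f x} * indicator {0..} t \<partial>lborel)"
proof -
  interpret pair_sigma_finite M lborel ..
  have "(\<integral>\<^sup>+x. f x \<partial>M) = (\<integral>\<^sup>+x. \<integral>\<^sup>+t. indicator {z \<in> space (M \<Otimes>\<^sub>M lborel). 0 \<le> snd z \<and> snd z < f (fst z)} (x, t) \<partial>lborel \<partial>M)"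
  proof (rule nn_integral_cong)
    fix x assume x: "x \<in> space M"
    have "(\<integral>\<^sup>+t. indicator {z \<in> space (M \<Otimes>\<^sub>M lborel). 0 \<le> snd z \<and> snd z < f (fst z)} (x, t) \<partial>lborel)
        = (\<integral>\<^sup>+t. indicator {0..<f x} t \<partial>lborel)"
      using x by (intro nn_integral_cong) (auto simp: indicator_def space_pair_measure)
    then show "ennreal (f x) = (\<integral>\<^sup>+t. indicator {z \<in> space (M \<Otimes>\<^sub>M lborel). 0 \<le> snd z \<and> snd z < f (fst z)} (x, t) \<partial>lborel)"
      using nonneg[of x] by simp
  qed
  also have "\<dots> = (\<integral>\<^sup>+t. \<integral>\<^sup>+x. indicator {z \<in> space (M \<Otimes>\<^sub>M lborel). 0 \<le> snd z \<and> snd z < f (fst z)} (x, t) \<partial>M \<partial>lborel)"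
    by (rule Fubini'[symmetric]) measurable
  also have "\<dots> = (\<integral>\<^sup>+t. emeasure M {x \<in> space M. t < f x} * indicator {0..} t \<partial>lborel)"
  proof (rule nn_integral_cong)
    fix t :: real
    have "(\<integral>\<^sup>+x. indicator {z \<in> space (M \<Otimes>\<^sub>M lborel). 0 \<le> snd z \<and> snd z < f (fst z)} (x, t) \<partial>M)
        = (\<integral>\<^sup>+x. indicator {x \<in> space M. t < f x} x * indicator {0..} t \<partial>M)"
      by (intro nn_integral_cong) (auto simp: indicator_def space_pair_measure)
    also have "\<dots> = emeasure M {x \<in> space M. t < f x} * indicator {0..} t"
      by (simp add: nn_integral_multc)
    finally show "(\<integral>\<^sup>+x. indicator {z \<in> space (M \<Otimes>\<^sub>M lborel). 0 \<le> snd z \<and> snd z < f (fst z)} (x, t) \<partial>M)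
        = emeasure M {x \<in> space M. t < f x} * indicator {0..} t" .
  qed
  finally show ?thesis .
qed

text \<open>Turns the superlevel sets in the layer cake formula for a truncated power into tail
  events of \<open>\<bar>x\<bar>\<close> itself. Since \<open>0 \<le> t\<close>, a vanishing
  indicator excludes the left side.\<close>

lemma less_truncated_powr_iff:
  fixes x a t p :: real
  assumes "0 < p" "0 < a" "0 \<le> t"
  shows "t < \<bar>x\<bar> powr p * indicator {a<..} \<bar>x\<bar> \<longleftrightarrow> max a (t powr (1 / p)) < \<bar>x\<bar>"
proof -
  have "t < \<bar>x\<bar> powr p \<longleftrightarrow> t powr (1 / p) < \<bar>x\<bar>"
    using powr_less_mono2[of "1/p" t "\<bar>x\<bar> powr p"] powr_less_mono2[of p "t powr (1 / p)" "\<bar>x\<bar>"]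
      assms by (auto simp: powr_powr)
  then show ?thesis
    using assms by (auto simp: indicator_def)
qed

text \<open>By the layer cake formula both sides are integrals of tail probabilities over the level
  \<open>t\<close>, so the domination is applied under the integral. Working with nonnegative
  integrals avoids any prior integrability of the \<open>X k\<close>.\<close>

lemma sum_nn_integral_truncated_powr_le:
  fixes X :: "nat \<Rightarrow> 'a \<Rightarrow> real" and Y :: "'b \<Rightarrow> real"
  assumes "prob_space M" "prob_space N"
    and X: "\<And>k. k \<in> {1..n} \<Longrightarrow> X k \<in> borel_measurable M" and Y: "Y \<in> borel_measurable N"
    and p: "0 < p" and a: "0 < a" and C: "0 \<le> C"
    and dom: "\<And>x. 0 < x \<Longrightarrow> (\<Sum>k=1..n. measure M {\<omega> \<in> space M. \<bar>X k \<omega>\<bar> > x})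
             \<le> C * measure N {\<omega> \<in> space N. \<bar>Y \<omega>\<bar> > x}"
  shows "(\<Sum>k=1..n. \<integral>\<^sup>+\<omega>. ennreal (\<bar>X k \<omega>\<bar> powr p * indicator {a<..} \<bar>X k \<omega>\<bar>) \<partial>M)
    \<le> ennreal C * (\<integral>\<^sup>+\<omega>. ennreal (\<bar>Y \<omega>\<bar> powr p * indicator {a<..} \<bar>Y \<omega>\<bar>) \<partial>N)"
proof -
  interpret M: prob_space M by fact
  interpret N: prob_space N by fact
  \<comment> \<open>Kept general in the probability space, to serve both the \<open>X k\<close> on
    \<open>M\<close> and \<open>Y\<close> on \<open>N\<close>.\<close>
  have layer: "(\<integral>\<^sup>+\<omega>. ennreal (\<bar>Z \<omega>\<bar> powr p * indicator {a<..} \<bar>Z \<omega>\<bar>) \<partial>L)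
      = (\<integral>\<^sup>+t. emeasure L {\<omega> \<in> space L. max a (t powr (1 / p)) < \<bar>Z \<omega>\<bar>} * indicator {0..} t \<partial>lborel)"
    if "prob_space L" and [measurable]: "Z \<in> borel_measurable L" for L :: "'c measure" and Z
  proof -
    interpret L: prob_space L by fact
    show ?thesis
      by (subst L.nn_integral_layer_cake)
         (auto intro!: nn_integral_cong simp: indicator_def[of "{0..}"] less_truncated_powr_iff[OF p a])
  qed
  let ?m = "\<lambda>t. max a (t powr (1 / p))"
  have meas: "(\<lambda>t. emeasure L {\<omega> \<in> space L. ?m t < \<bar>Z \<omega>\<bar>} * indicator {0..} t) \<in> borel_measurable lborel"
    if "prob_space L" and [measurable]: "Z \<in> borel_measurable L" for L :: "'c measure" and Z
  proof -
    interpret L: prob_space L by fact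
    show ?thesis by measurable
  qed
  have "(\<Sum>k=1..n. \<integral>\<^sup>+\<omega>. ennreal (\<bar>X k \<omega>\<bar> powr p * indicator {a<..} \<bar>X k \<omega>\<bar>) \<partial>M)
      = (\<Sum>k=1..n. \<integral>\<^sup>+t. emeasure M {\<omega> \<in> space M. ?m t < \<bar>X k \<omega>\<bar>} * indicator {0..} t \<partial>lborel)"
    by (intro sum.cong refl layer X M.prob_space_axioms)
  also have "\<dots> = (\<integral>\<^sup>+t. (\<Sum>k=1..n. emeasure M {\<omega> \<in> space M. ?m t < \<bar>X k \<omega>\<bar>} * indicator {0..} t) \<partial>lborel)"
    by (intro nn_integral_sum[symmetric] meas X M.prob_space_axioms)
  also have "\<dots> \<le> (\<integral>\<^sup>+t. ennreal C * (emeasure N {\<omega> \<in> space N. ?m t < \<bar>Y \<omega>\<bar>} * indicator {0..} t) \<partial>lborel)"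
  proof (rule nn_integral_mono)
    fix t :: real
    have "(\<Sum>k=1..n. emeasure M {\<omega> \<in> space M. ?m t < \<bar>X k \<omega>\<bar>})
        = ennreal (\<Sum>k=1..n. measure M {\<omega> \<in> space M. ?m t < \<bar>X k \<omega>\<bar>})"
      by (simp add: M.emeasure_eq_measure)
    \<comment> \<open>\<open>dom\<close> needs a positive level; \<open>?m t\<close> is at least
      \<open>a\<close>, hence positive even where \<open>t powr (1 / p)\<close> is 0.\<close>
    also have "\<dots> \<le> ennreal (C * measure N {\<omega> \<in> space N. ?m t < \<bar>Y \<omega>\<bar>})"
      using a by (intro ennreal_leI dom) auto
    also have "\<dots> = ennreal C * emeasure N {\<omega> \<in> space N. ?m t < \<bar>Y \<omega>\<bar>}"
      using C by (simp add: N.emeasure_eq_measure ennreal_mult)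
    finally show "(\<Sum>k=1..n. emeasure M {\<omega> \<in> space M. ?m t < \<bar>X k \<omega>\<bar>} * indicator {0..} t)
        \<le> ennreal C * (emeasure N {\<omega> \<in> space N. ?m t < \<bar>Y \<omega>\<bar>} * indicator {0..} t)"
      by (auto simp: indicator_def[of "{0..}"])
  qed
  also have "\<dots> = ennreal C * (\<integral>\<^sup>+\<omega>. ennreal (\<bar>Y \<omega>\<bar> powr p * indicator {a<..} \<bar>Y \<omega>\<bar>) \<partial>N)"
    by (simp only: nn_integral_cmult[OF meas[OF assms(2) Y]] layer[OF assms(2) Y])
  finally show ?thesis .
qed


section \<open>Second moments of the coordinates on the sphere\<close>

text \<open>Column \<open>k\<close> is \<open>s k\<close> times the unit vector with index
  \<open>\<pi> k\<close>. Since \<open>\<pi>\<close> is injective, distinct columns have disjoint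
  supports, and the signs square to 1.\<close>

lemma orthogonal_mat_signed_permutation:
  assumes \<pi>: "\<pi> permutes {1..n}" and s: "\<And>k. s k \<in> {1, -1}"
  shows "orthogonal_mat n (\<lambda>i k. if i = \<pi> k then s k else 0)"
  unfolding orthogonal_mat_def
proof (intro ballI)
  fix i j assume ij: "i \<in> {1..n}" "j \<in> {1..n}"
  have "(\<Sum>k = 1..n. (if k = \<pi> i then s i else 0) * (if k = \<pi> j then s j else 0))
      = (\<Sum>k = 1..n. if k = \<pi> i then s i * (if \<pi> i = \<pi> j then s j else 0) else 0)"
    by (intro sum.cong) auto
  also have "\<dots> = s i * (if \<pi> i = \<pi> j then s j else 0)"
    using permutes_in_image[OF \<pi>, of i] ij by simp
  also have "\<dots> = (if i = j then 1 else 0)"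
    using s[of i] permutes_inj[OF \<pi>] by (auto simp: inj_eq)
  finally show "(\<Sum>k = 1..n. (if k = \<pi> i then s i else 0) * (if k = \<pi> j then s j else 0))
      = (if i = j then 1 else 0)" .
qed

lemma mat_apply_signed_permutation:
  assumes \<pi>: "\<pi> permutes {1..n}" and i: "i \<in> {1..n}"
  shows "mat_apply n (\<lambda>i k. if i = \<pi> k then s k else 0) u (\<pi> i) = s i * u i"
proof -
  have "mat_apply n (\<lambda>i k. if i = \<pi> k then s k else 0) u (\<pi> i)
      = (\<Sum>k=1..n. (if \<pi> i = \<pi> k then s k else 0) * u k)"
    using permutes_in_image[OF \<pi>, of i] i by (simp add: mat_apply_def)
  also have "\<dots> = (\<Sum>k=1..n. if k = i then s k * u k else 0)"
    using permutes_inj[OF \<pi>] by (intro sum.cong) (auto simp: inj_eq)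
  finally show ?thesis using i by simp
qed

context
  fixes n :: nat and P :: "(nat \<Rightarrow> real) measure"
  assumes P: "uniform_on_sphere n P"
begin

lemma sets_uniform: "sets P = sets (sphere_algebra n)"
  using P by (simp add: uniform_on_sphere_def)

lemma space_uniform: "space P = unit_sphere n"
proof -
  have "unit_sphere n \<subseteq> space (PiM {1..n} (\<lambda>_. borel))"
    by (auto simp: unit_sphere_def space_PiM)
  then show ?thesis
    using sets_eq_imp_space_eq[OF sets_uniform] by (auto simp: sphere_algebra_def space_restrict_space)
qed

interpretation prob_space P
  using P by (simp add: uniform_on_sphere_def)

lemma measurable_coordinate:
  assumes "k \<in> {1..n}"
  shows "(\<lambda>u. u k) \<in> borel_measurable P"
proof -
  have "(\<lambda>u. u k) \<in> borel_measurable (sphere_algebra n)"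
    unfolding sphere_algebra_def using assms by (intro measurable_restrict_space1) simp
  then show ?thesis
    using measurable_cong_sets[OF sets_uniform refl] by blast
qed

lemma coordinate_le_1:
  assumes "u \<in> space P" "k \<in> {1..n}"
  shows "\<bar>u k\<bar> \<le> 1"
proof -
  have "(u k)\<^sup>2 \<le> (\<Sum>k=1..n. (u k)\<^sup>2)"
    using assms(2) by (intro member_le_sum) auto
  then show ?thesis
    using assms(1) by (auto simp: space_uniform unit_sphere_def abs_square_le_1)
qed

lemma integrable_coordinates:
  assumes "i \<in> {1..n}" "j \<in> {1..n}"
  shows "integrable P (\<lambda>u. u i * u j)"
proof (rule integrable_const_bound[where B = 1])
  show "AE u in P. norm (u i * u j) \<le> 1"
    using coordinate_le_1 assms by (intro AE_I2) (auto simp: abs_mult intro!: mult_le_one)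
qed (use measurable_coordinate assms in measurable)

text \<open>Change of variables along a signed permutation matrix, whose image measure of
  \<open>P\<close> is \<open>P\<close> again.\<close>

lemma expectation_signed_permutation:
  assumes \<pi>: "\<pi> permutes {1..n}" and s: "\<And>k. s k \<in> {1, -1}"
    and ij: "i \<in> {1..n}" "j \<in> {1..n}"
  shows "expectation (\<lambda>u. u (\<pi> i) * u (\<pi> j)) = s i * s j * expectation (\<lambda>u. u i * u j)"
proof -
  let ?A = "\<lambda>i k. if i = \<pi> k then s k else 0"
  have A: "orthogonal_mat n ?A"
    by (rule orthogonal_mat_signed_permutation[OF \<pi> s])
  have meas: "mat_apply n ?A \<in> measurable P P"
    using measurable_mat_apply[OF A] measurable_cong_sets[OF sets_uniform sets_uniform] by blast
  have \<pi>ij: "\<pi> i \<in> {1..n}" "\<pi> j \<in> {1..n}"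
    using permutes_in_image[OF \<pi>] ij by auto
  have "expectation (\<lambda>u. u (\<pi> i) * u (\<pi> j)) = (\<integral>u. u (\<pi> i) * u (\<pi> j) \<partial>distr P P (mat_apply n ?A))"
    using P A by (simp add: uniform_on_sphere_def)
  also have "\<dots> = expectation (\<lambda>u. mat_apply n ?A u (\<pi> i) * mat_apply n ?A u (\<pi> j))"
    using meas borel_measurable_integrable[OF integrable_coordinates[OF \<pi>ij]] by (rule integral_distr)
  also have "\<dots> = expectation (\<lambda>u. s i * s j * (u i * u j))"
    using mat_apply_signed_permutation[OF \<pi>] ij by (simp add: mult_ac)
  finally show ?thesis by simp
qed

lemma expectation_coordinates:
  assumes ij: "i \<in> {1..n}" "j \<in> {1..n}"
  shows "expectation (\<lambda>u. u i * u j) = (if i = j then 1 / real n else 0)"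
proof (cases "i = j")
  case False
  \<comment> \<open>Flipping the sign of coordinate \<open>i\<close> alone negates the
    product.\<close>
  have "expectation (\<lambda>u. u i * u j) = - expectation (\<lambda>u. u i * u j)"
    using expectation_signed_permutation[OF permutes_id, of "\<lambda>k. if k = i then -1 else 1" i j] ij False
    by simp
  then show ?thesis using False by simp
next
  case True
  \<comment> \<open>Swapping \<open>i\<close> and \<open>k\<close> makes all second moments equal;
    their sum is 1 because the squares add up to 1 on the sphere.\<close>
  have "expectation (\<lambda>u. u k * u k) = expectation (\<lambda>u. u i * u i)" if "k \<in> {1..n}" for k
    using expectation_signed_permutation[OF permutes_swap_id[OF ij(1) that], of "\<lambda>_. 1" i i] ij
    by simp
  then have "real n * expectation (\<lambda>u. u i * u i) = (\<Sum>k=1..n. expectation (\<lambda>u. u k * u k))"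
    by simp
  also have "\<dots> = expectation (\<lambda>u. \<Sum>k=1..n. u k * u k)"
    by (rule Bochner_Integration.integral_sum[symmetric]) (rule integrable_coordinates)
  also have "\<dots> = expectation (\<lambda>u. 1)"
    by (intro Bochner_Integration.integral_cong)
       (auto simp: space_uniform unit_sphere_def power2_eq_square)
  finally show ?thesis
    using ij True by (simp add: prob_space field_simps)
qed

text \<open>Expanding the square gives a double sum in which only the diagonal terms survive, each
  with weight \<open>1 / real n\<close>.\<close>

lemma expectation_linear_form_squared:
  shows "integrable P (\<lambda>u. (\<Sum>k=1..n. u k * x k)\<^sup>2)"
    and "expectation (\<lambda>u. (\<Sum>k=1..n. u k * x k)\<^sup>2) = (\<Sum>k=1..n. (x k)\<^sup>2) / real n"
proof -
  have eq: "(\<Sum>k=1..n. u k * x k)\<^sup>2 = (\<Sum>i=1..n. \<Sum>j=1..n. x i * x j * (u i * u j))" for u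
    by (simp add: power2_eq_square sum_product mult_ac)
  have int: "integrable P (\<lambda>u. x i * x j * (u i * u j))" if "i \<in> {1..n}" "j \<in> {1..n}" for i j
    using integrable_coordinates[OF that] by simp
  show "integrable P (\<lambda>u. (\<Sum>k=1..n. u k * x k)\<^sup>2)"
    unfolding eq by (intro Bochner_Integration.integrable_sum int)
  have "expectation (\<lambda>u. (\<Sum>k=1..n. u k * x k)\<^sup>2)
      = (\<Sum>i=1..n. expectation (\<lambda>u. \<Sum>j=1..n. x i * x j * (u i * u j)))"
    unfolding eq by (intro Bochner_Integration.integral_sum Bochner_Integration.integrable_sum int)
  also have "\<dots> = (\<Sum>i=1..n. \<Sum>j=1..n. expectation (\<lambda>u. x i * x j * (u i * u j)))"
    by (intro sum.cong refl Bochner_Integration.integral_sum int)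
  also have "\<dots> = (\<Sum>i=1..n. \<Sum>j=1..n. if i = j then x i * x j / real n else 0)"
    using expectation_coordinates by (intro sum.cong refl) simp
  also have "\<dots> = (\<Sum>k=1..n. (x k)\<^sup>2) / real n"
    by (simp add: power2_eq_square sum_divide_distrib)
  finally show "expectation (\<lambda>u. (\<Sum>k=1..n. u k * x k)\<^sup>2) = (\<Sum>k=1..n. (x k)\<^sup>2) / real n" .
qed

section \<open>Pointwise bounds and measurability of the spherical moment\<close>

text \<open>For fixed \<open>\<omega>\<close> the integrand is the power \<open>p / 2 < 1\<close> of
  a squared linear form, so Jensen's inequality reduces it to the second moment.\<close>

lemma sphere_moment_le:
  assumes p: "0 < p" "p < 2"
  shows "sphere_moment P p X n \<omega> \<le> ((\<Sum>k=1..n. (X k \<omega>)\<^sup>2) / real n) powr (p / 2)"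
proof -
  let ?S = "\<lambda>u. \<Sum>k=1..n. u k * X k \<omega>"
  have "\<bar>?S u\<bar> powr p = (?S u)\<^sup>2 powr (p / 2)" for u
    using powr_powr[of "\<bar>?S u\<bar>" 2 "p / 2"] by simp
  then have "sphere_moment P p X n \<omega> = expectation (\<lambda>u. (?S u)\<^sup>2 powr (p / 2))"
    by (simp add: sphere_moment_def)
  also have "\<dots> \<le> expectation (\<lambda>u. (?S u)\<^sup>2) powr (p / 2)"
    using p expectation_linear_form_squared(1) by (intro expectation_powr_le) auto
  finally show ?thesis
    by (simp only: expectation_linear_form_squared(2))
qed

text \<open>The integrand is jointly measurable on the product of \<open>M\<close> and
  \<open>P\<close>, so integrating out \<open>u\<close> leaves a measurable function of
  \<open>\<omega>\<close>.\<close>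

lemma borel_measurable_sphere_moment:
  assumes X: "\<And>k. k \<in> {1..n} \<Longrightarrow> X k \<in> borel_measurable M"
  shows "sphere_moment P p X n \<in> borel_measurable M"
proof -
  have [measurable]: "(\<lambda>z. snd z k * X k (fst z)) \<in> borel_measurable (M \<Otimes>\<^sub>M P)" if "k \<in> {1..n}" for k
    using measurable_compose[OF measurable_fst X[OF that]]
      measurable_compose[OF measurable_snd measurable_coordinate[OF that]]
    by (rule borel_measurable_times[rotated])
  have "(\<lambda>z. \<bar>\<Sum>k=1..n. snd z k * X k (fst z)\<bar> powr p) \<in> borel_measurable (M \<Otimes>\<^sub>M P)"
    by measurable
  then have "(\<lambda>\<omega>. \<integral>u. \<bar>\<Sum>k=1..n. u k * X k \<omega>\<bar> powr p \<partial>P) \<in> borel_measurable M"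
    by (intro borel_measurable_lebesgue_integral) (simp add: case_prod_beta)
  then show ?thesis
    by (simp add: sphere_moment_def[abs_def])
qed

lemma scaled_sphere_moment_le_truncated:
  assumes p: "0 < p" "p < 2" and a: "0 < a" and n: "0 < n"
  shows "real n powr (p / 2 - 1) * sphere_moment P p X n \<omega>
    \<le> a powr p * real n powr (p / 2 - 1)
      + 1 / real n * (\<Sum>k=1..n. \<bar>X k \<omega>\<bar> powr p * indicator {a<..} \<bar>X k \<omega>\<bar>)"
proof -
  have np: "real n powr (p / 2 - 1) = real n powr (p / 2) / real n"
    using n by (simp add: powr_diff)
  have "real n powr (p / 2 - 1) * sphere_moment P p X n \<omega>
      \<le> real n powr (p / 2 - 1) * ((\<Sum>k=1..n. (X k \<omega>)\<^sup>2) / real n) powr (p / 2)"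
    by (intro mult_left_mono sphere_moment_le p) auto
  \<comment> \<open>The factor \<open>real n powr (p / 2)\<close> cancels against the denominator
    inside the power, leaving only \<open>1 / real n\<close>.\<close>
  also have "\<dots> = 1 / real n * (\<Sum>k=1..n. (X k \<omega>)\<^sup>2) powr (p / 2)"
    using n by (simp add: np powr_divide)
  also have "\<dots> \<le> 1 / real n * (real n powr (p / 2) * a powr p
      + (\<Sum>k=1..n. \<bar>X k \<omega>\<bar> powr p * indicator {a<..} \<bar>X k \<omega>\<bar>))"
    by (intro mult_left_mono powr_sum_squares_le_truncated p a) auto
  finally show ?thesis
    by (simp add: np distrib_left mult.commute)
qed

end

section \<open>Convergence in probability and vanishing truncated moments\<close>

text \<open>Markov's inequality bounds each deviation probability by the mean deviation divided by
  \<open>\<epsilon>\<close>.\<close>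

lemma tendsto_in_L1_imp_tendsto_in_prob:
  assumes "prob_space M" and T: "tendsto_in_L1 M T Z"
  shows "tendsto_in_prob M T Z"
  unfolding tendsto_in_prob_def
proof (intro conjI allI impI)
  interpret prob_space M by fact
  have Z: "integrable M Z" and Tn: "\<forall>\<^sub>F n in sequentially. integrable M (T n)"
    and lim: "(\<lambda>n. \<integral>\<omega>. \<bar>T n \<omega> - Z \<omega>\<bar> \<partial>M) \<longlonglongrightarrow> 0"
    using T by (auto simp: tendsto_in_L1_def)
  show "Z \<in> borel_measurable M"
    using Z by auto
  show "\<forall>\<^sub>F n in sequentially. T n \<in> borel_measurable M"
    using Tn by (rule eventually_mono) auto
  fix \<epsilon> :: real assume \<epsilon>: "\<epsilon> > 0"
  show "(\<lambda>n. measure M {\<omega> \<in> space M. \<bar>T n \<omega> - Z \<omega>\<bar> > \<epsilon>}) \<longlonglongrightarrow> 0"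
  proof (rule tendsto_sandwich[OF _ _ tendsto_const])
    show "\<forall>\<^sub>F n in sequentially. measure M {\<omega> \<in> space M. \<bar>T n \<omega> - Z \<omega>\<bar> > \<epsilon>}
        \<le> (\<integral>\<omega>. \<bar>T n \<omega> - Z \<omega>\<bar> \<partial>M) / \<epsilon>"
      using Tn
    proof (rule eventually_mono)
      fix n assume Tn: "integrable M (T n)"
      have [measurable]: "T n \<in> borel_measurable M" "Z \<in> borel_measurable M"
        using Tn Z by auto
      have "measure M {\<omega> \<in> space M. \<bar>T n \<omega> - Z \<omega>\<bar> > \<epsilon>} \<le> measure M {\<omega> \<in> space M. \<epsilon> \<le> \<bar>T n \<omega> - Z \<omega>\<bar>}"
        by (intro finite_measure_mono) auto
      also have "\<dots> \<le> (\<integral>\<omega>. \<bar>T n \<omega> - Z \<omega>\<bar> \<partial>M) / \<epsilon>"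
        using Tn Z \<epsilon> by (intro integral_Markov_inequality_measure[where A = "{}"]) auto
      finally show "measure M {\<omega> \<in> space M. \<bar>T n \<omega> - Z \<omega>\<bar> > \<epsilon>} \<le> (\<integral>\<omega>. \<bar>T n \<omega> - Z \<omega>\<bar> \<partial>M) / \<epsilon>" .
    qed
    show "(\<lambda>n. (\<integral>\<omega>. \<bar>T n \<omega> - Z \<omega>\<bar> \<partial>M) / \<epsilon>) \<longlonglongrightarrow> 0"
      using tendsto_divide[OF lim tendsto_const[of \<epsilon>]] \<epsilon> by simp
  qed auto
qed

text \<open>Dominated convergence in the continuous parameter \<open>a\<close>: at each point the
  indicator is 0 once \<open>a\<close> reaches \<open>\<bar>Y \<omega>\<bar>\<close>, and
  \<open>\<bar>Y \<omega>\<bar> powr p\<close> dominates.\<close>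

lemma integral_truncated_tendsto_0:
  fixes Y :: "'b \<Rightarrow> real"
  assumes [measurable]: "Y \<in> borel_measurable N" and int: "integrable N (\<lambda>\<omega>. \<bar>Y \<omega>\<bar> powr p)"
  shows "((\<lambda>a. \<integral>\<omega>. \<bar>Y \<omega>\<bar> powr p * indicator {a<..} \<bar>Y \<omega>\<bar> \<partial>N) \<longlongrightarrow> 0) at_top"
proof -
  have "((\<lambda>a. \<integral>\<omega>. \<bar>Y \<omega>\<bar> powr p * indicator {a<..} \<bar>Y \<omega>\<bar> \<partial>N) \<longlongrightarrow> (\<integral>\<omega>. 0 \<partial>N)) at_top"
  proof (rule integral_dominated_convergence_at_top[OF _ _ int])
    show "AE \<omega> in N. ((\<lambda>a. \<bar>Y \<omega>\<bar> powr p * indicator {a<..} \<bar>Y \<omega>\<bar>) \<longlongrightarrow> 0) at_top"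
    proof (intro AE_I2 tendsto_eventually)
      fix \<omega>
      show "\<forall>\<^sub>F a in at_top. \<bar>Y \<omega>\<bar> powr p * indicator {a<..} \<bar>Y \<omega>\<bar> = (0::real)"
        using eventually_ge_at_top[of "\<bar>Y \<omega>\<bar>"] by (rule eventually_mono) auto
    qed
    show "\<forall>\<^sub>F a in at_top. AE \<omega> in N. norm (\<bar>Y \<omega>\<bar> powr p * indicator {a<..} \<bar>Y \<omega>\<bar>) \<le> \<bar>Y \<omega>\<bar> powr p"
      by (intro always_eventually allI AE_I2) (auto simp: indicator_def)
  qed measurable
  then show ?thesis by simp
qed



section \<open>Uniform estimate of the mean and passage to the limit\<close>

theorem theorem3p1:
  fixes M :: "'a measure" and N :: "'b measure"
    and X :: "nat \<Rightarrow> 'a \<Rightarrow> real" and Y :: "'b \<Rightarrow> real"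
    and P\<theta> :: "nat \<Rightarrow> (nat \<Rightarrow> real) measure"
    and C p :: real
  assumes "prob_space M"
    and "\<And>k. k \<ge> 1 \<Longrightarrow> X k \<in> borel_measurable M"
    and "prob_space N"
    and "Y \<in> borel_measurable N"
    and "\<And>n. n \<ge> 2 \<Longrightarrow> uniform_on_sphere n (P\<theta> n)"
    and "C > 0"
    and "\<And>n x. n \<ge> 1 \<Longrightarrow> x > 0 \<Longrightarrow>
           1 / real n * (\<Sum>k=1..n. measure M {\<omega> \<in> space M. \<bar>X k \<omega>\<bar> > x})
             \<le> C * measure N {\<omega> \<in> space N. \<bar>Y \<omega>\<bar> > x}"
    and "0 < p" and "p < 2"
    and "integrable N (\<lambda>\<omega>. \<bar>Y \<omega>\<bar> powr p)"
  defines "T \<equiv> \<lambda>n \<omega>. real n powr (p / 2 - 1) * sphere_moment (P\<theta> n) p X n \<omega>"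
  shows "tendsto_in_prob M T (\<lambda>_. 0)
       \<and> (\<forall>n\<ge>2. integrable M (T n)) \<and> tendsto_in_L1 M T (\<lambda>_. 0)"
proof -
  interpret M: prob_space M by fact
  interpret N: prob_space N by fact
  note p = \<open>0 < p\<close> \<open>p < 2\<close>
  note P\<theta> = assms(5)
  have [measurable]: "Y \<in> borel_measurable N" by fact
  have X: "X k \<in> borel_measurable M" if "k \<in> {1..n}" for k n
    using assms(2) that by simp
  let ?Xa = "\<lambda>a k \<omega>. \<bar>X k \<omega>\<bar> powr p * indicator {a<..} \<bar>X k \<omega>\<bar>"
  define y where "y a = (\<integral>\<omega>. \<bar>Y \<omega>\<bar> powr p * indicator {a<..} \<bar>Y \<omega>\<bar> \<partial>N)" for a
  have int_Y: "integrable N (\<lambda>\<omega>. \<bar>Y \<omega>\<bar> powr p * indicator {a<..} \<bar>Y \<omega>\<bar>)" for a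
    by (rule Bochner_Integration.integrable_bound[OF assms(10)]) (auto simp: indicator_def)
  have trunc: "integrable M (\<lambda>\<omega>. \<Sum>k=1..n. ?Xa a k \<omega>)"
      "(\<integral>\<omega>. (\<Sum>k=1..n. ?Xa a k \<omega>) \<partial>M) \<le> real n * C * y a"
    if a: "0 < a" and n: "1 \<le> n" for a n
  proof -
    have meas: "(\<lambda>\<omega>. \<Sum>k=1..n. ?Xa a k \<omega>) \<in> borel_measurable M"
    proof (rule borel_measurable_sum)
      fix k assume "k \<in> {1..n}"
      note [measurable] = X[OF this]
      show "?Xa a k \<in> borel_measurable M" by measurable
    qed
    have meas1: "(\<lambda>\<omega>. ennreal (?Xa a k \<omega>)) \<in> borel_measurable M" if "k \<in> {1..n}" for k
    proof -
      note [measurable] = X[OF that]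
      show ?thesis by measurable
    qed
    have "(\<integral>\<^sup>+\<omega>. ennreal (\<Sum>k=1..n. ?Xa a k \<omega>) \<partial>M) = (\<integral>\<^sup>+\<omega>. (\<Sum>k=1..n. ennreal (?Xa a k \<omega>)) \<partial>M)"
      by (simp add: sum_ennreal)
    also have "\<dots> = (\<Sum>k=1..n. \<integral>\<^sup>+\<omega>. ennreal (?Xa a k \<omega>) \<partial>M)"
      by (rule nn_integral_sum) (rule meas1)
    \<comment> \<open>The hypothesis bounds averages of tails; clearing the factor
      \<open>1 / real n\<close> makes the constant \<open>real n * C\<close>.\<close>
    also have "\<dots> \<le> ennreal (real n * C) * (\<integral>\<^sup>+\<omega>. ennreal (\<bar>Y \<omega>\<bar> powr p * indicator {a<..} \<bar>Y \<omega>\<bar>) \<partial>N)"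
    proof (rule sum_nn_integral_truncated_powr_le[OF assms(1,3) X assms(4) p(1) a])
      show "0 \<le> real n * C" using \<open>C > 0\<close> by simp
      fix x :: real assume "0 < x"
      from assms(7)[OF n this]
      show "(\<Sum>k=1..n. measure M {\<omega> \<in> space M. \<bar>X k \<omega>\<bar> > x})
          \<le> real n * C * measure N {\<omega> \<in> space N. \<bar>Y \<omega>\<bar> > x}"
        using n by (simp add: field_simps)
    qed
    also have "\<dots> = ennreal (real n * C * y a)"
      unfolding y_def using \<open>C > 0\<close> by (subst nn_integral_eq_integral[OF int_Y]) (auto simp flip: ennreal_mult)
    finally have le: "(\<integral>\<^sup>+\<omega>. ennreal (\<Sum>k=1..n. ?Xa a k \<omega>) \<partial>M) \<le> ennreal (real n * C * y a)" .
    have nonneg: "AE \<omega> in M. 0 \<le> (\<Sum>k=1..n. ?Xa a k \<omega>)"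
      by (intro AE_I2 sum_nonneg) simp
    have fin: "(\<integral>\<^sup>+\<omega>. ennreal (\<Sum>k=1..n. ?Xa a k \<omega>) \<partial>M) < \<infinity>"
      by (rule le_less_trans[OF le]) simp
    show int: "integrable M (\<lambda>\<omega>. \<Sum>k=1..n. ?Xa a k \<omega>)"
      by (rule integrableI_nonneg[OF meas nonneg fin])
    \<comment> \<open>\<open>ennreal\<close> sends negative reals to 0, so returning to a real
      inequality requires a nonnegative bound.\<close>
    have "0 \<le> real n * C * y a"
      using \<open>C > 0\<close> by (simp add: y_def)
    then show "(\<integral>\<omega>. (\<Sum>k=1..n. ?Xa a k \<omega>) \<partial>M) \<le> real n * C * y a"
      using le by (simp only: nn_integral_eq_integral[OF int nonneg] ennreal_le_iff)
  qed
  have T_nonneg: "0 \<le> T n \<omega>" for n \<omega>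
    by (simp add: T_def sphere_moment_def)
  have T_le: "T n \<omega> \<le> a powr p * real n powr (p / 2 - 1) + 1 / real n * (\<Sum>k=1..n. ?Xa a k \<omega>)"
    if "0 < a" "2 \<le> n" for a n \<omega>
    unfolding T_def using scaled_sphere_moment_le_truncated[OF P\<theta> p] that by simp
  have bound_int: "integrable M (\<lambda>\<omega>. a powr p * real n powr (p / 2 - 1) + 1 / real n * (\<Sum>k=1..n. ?Xa a k \<omega>))"
    if "0 < a" "2 \<le> n" for a n
    using trunc(1)[of a n] that by simp
  have T_int: "integrable M (T n)" if n: "2 \<le> n" for n
  \<comment> \<open>Any positive truncation level would do for integrability; level 1 is
    taken.\<close>
  proof (rule Bochner_Integration.integrable_bound[OF bound_int[OF zero_less_one n]])
    have "sphere_moment (P\<theta> n) p X n \<in> borel_measurable M"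
      by (rule borel_measurable_sphere_moment[OF P\<theta>[OF n]]) (rule X)
    then show "T n \<in> borel_measurable M"
      unfolding T_def by (rule borel_measurable_times[OF borel_measurable_const])
    show "AE \<omega> in M. norm (T n \<omega>)
        \<le> norm (1 powr p * real n powr (p / 2 - 1) + 1 / real n * (\<Sum>k=1..n. ?Xa 1 k \<omega>))"
      unfolding real_norm_def abs_of_nonneg[OF T_nonneg]
      by (intro AE_I2 order_trans[OF T_le[OF zero_less_one n] abs_ge_self])
  qed
  have ET_le: "(\<integral>\<omega>. T n \<omega> \<partial>M) \<le> a powr p * real n powr (p / 2 - 1) + C * y a" if a: "0 < a" and n: "2 \<le> n" for a n
  proof -
    have "(\<integral>\<omega>. T n \<omega> \<partial>M)
        \<le> (\<integral>\<omega>. a powr p * real n powr (p / 2 - 1) + 1 / real n * (\<Sum>k=1..n. ?Xa a k \<omega>) \<partial>M)"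
      by (intro integral_mono T_int bound_int T_le a n)
    also have "\<dots> = a powr p * real n powr (p / 2 - 1) + 1 / real n * (\<integral>\<omega>. (\<Sum>k=1..n. ?Xa a k \<omega>) \<partial>M)"
      \<comment> \<open>The sum stays inside the integral, in the form in which \<open>trunc\<close>
        provides its integrability and bound.\<close>
      using trunc(1)[of a n] a n by (simp add: M.prob_space del: Bochner_Integration.integral_sum)
    also have "\<dots> \<le> a powr p * real n powr (p / 2 - 1) + 1 / real n * (real n * C * y a)"
      using trunc(2)[of a n] a n by (intro add_left_mono mult_left_mono) auto
    finally show ?thesis using n by simp
  qed
  have "(\<lambda>n. \<integral>\<omega>. T n \<omega> \<partial>M) \<longlonglongrightarrow> 0"
  proof (rule order_tendstoI)
    fix e :: real assume e: "e < 0"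
    show "\<forall>\<^sub>F n in sequentially. e < (\<integral>\<omega>. T n \<omega> \<partial>M)"
      using e T_nonneg by (intro always_eventually allI) (auto intro: less_le_trans integral_nonneg)
  next
    fix e :: real assume e: "0 < e"
    \<comment> \<open>The level \<open>a\<close> is fixed first, making the tail term small
      uniformly in \<open>n\<close>; only then is \<open>n\<close> taken large to remove the term
      with the negative exponent \<open>p / 2 - 1\<close>.\<close>
    have "((\<lambda>a. C * y a) \<longlongrightarrow> 0) at_top"
      unfolding y_def using integral_truncated_tendsto_0[OF assms(4,10)] by (rule tendsto_mult_right_zero)
    then have "\<forall>\<^sub>F a in at_top. C * y a < e / 2"
      using e by (intro order_tendstoD) auto
    then have "\<forall>\<^sub>F a in at_top. C * y a < e / 2 \<and> 0 < a"
      using eventually_gt_at_top by (rule eventually_conj)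
    then obtain a where a: "C * y a < e / 2" "0 < a"
      by (auto simp: eventually_at_top_linorder)
    have "(\<lambda>n. real n powr (p / 2 - 1)) \<longlonglongrightarrow> 0"
      using p by (intro tendsto_neg_powr filterlim_real_sequentially) simp
    then have "(\<lambda>n. a powr p * real n powr (p / 2 - 1)) \<longlonglongrightarrow> 0"
      by (rule tendsto_mult_right_zero)
    then have "\<forall>\<^sub>F n in sequentially. a powr p * real n powr (p / 2 - 1) < e / 2"
      using e by (intro order_tendstoD) auto
    then show "\<forall>\<^sub>F n in sequentially. (\<integral>\<omega>. T n \<omega> \<partial>M) < e"
      using eventually_ge_at_top[of 2]
    proof eventually_elim
      case (elim n)
      then show ?case using ET_le[OF a(2), of n] a(1) by linarith
    qed
  qed
  \<comment> \<open>As \<open>T n\<close> is nonnegative, its mean is its distance to 0 in the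
    mean.\<close>
  then have L1: "tendsto_in_L1 M T (\<lambda>_. 0)"
    using T_int T_nonneg eventually_mono[OF eventually_ge_at_top[of 2] T_int]
    by (simp add: tendsto_in_L1_def)
  then show ?thesis
    using T_int tendsto_in_L1_imp_tendsto_in_prob[OF assms(1)] by blast
qed

end
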